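(* (i) $\mathbf{B_F}$ is complete with respect to the class of all serial and transitive EGL-models: for every formula $\varphi$, if $\varphi$ is true in every serial and transitive model, then $\vdash_{\mathbf{B_F}}\varphi$. (ii) $\mathbf{T_F}$ is complete with respect to the class of all serial, transitive and reflexive EGL-models: for every formula $\varphi$, if $\varphi$ is true in every serial, transitive and reflexive model, then $\vdash_{\mathbf{T_F}}\varphi$.
   Context: Fix a set $\mathcal P$ of atomic propositions and a set $\mathcal A$ of agents. Formulas: $\varphi ::= p \mid \bot \mid \varphi\wedge\varphi \mid \varphi\to\varphi \mid B_a\varphi$ with $p\in\mathcal P$, $a\in\mathcal A$; $\neg\varphi=\varphi\to\bot$. An EGL-model (model) is $M=(S,(r_a)_{a\in\mathcal A},\pi)$ where $S$ is a non-empty countable set, each $r_a:S\times S\to[0,1]$, and $\pi:S\times\mathcal P\to[0,1]$. Values: $V_s(p)=\pi(s,p)$; $V_s(\bot)=0$; $V_s(\varphi\wedge\psi)=\min\{V_s(\varphi),V_s(\psi)\}$; $V_s(\varphi\to\psi)=1$ if $V_s(\varphi)\le V_s(\psi)$ and $=V_s(\psi)$ otherwise; $V_s(B_a\varphi)=\inf_{s'\in S}\max\{1-r_a(s,s'),V_{s'}(\varphi)\}$. $\varphi$ is true in $M$ if $V_s(\varphi)=1$ for all $s\in S$; $\varphi$ is valid if true in all models. $M$ is serial if for all $a,s$ there is $s'$ with $r_a(s,s')=1$; reflexive if $r_a(s,s)=1$ for all $a,s$; transitive if $r_a(s,s'')\ge\min\{r_a(s,s'),r_a(s',s'')\}$ for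 all $a,s,s',s''$. Axioms and rules: (A) all instances of tautologies of propositional Gödel logic; (K) $B_a(\varphi\to\psi)\to(B_a\varphi\to B_a\psi)$; (D) $\neg B_a\bot$; (4) $B_a\varphi\to B_aB_a\varphi$; (T) $B_a\varphi\to\varphi$; (R1) modus ponens; (R2) from $\varphi$ infer $B_a\varphi$. $\mathbf{K_F}$ = (A),(K),(R1),(R2); $\mathbf{B_F}$ = $\mathbf{K_F}$ + (D),(4); $\mathbf{T_F}$ = $\mathbf{B_F}$ + (T). $\vdash_{\mathbf A}\varphi$ means there is a finite sequence of formulas ending in $\varphi$ each of which is an axiom of $\mathbf A$ or is obtained from earlier ones by (R1) or (R2), with the restriction that (R2) cannot be applied to non-valid formulas.
   Formalization: In the restriction on (R2), "valid" is read as true in all serial transitive models (for B_F), resp. all serial, transitive and reflexive models (for T_F), not in all models; with the literal reading B_a(¬B_a⊥) is true in every serial model but not derivable. *)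

theory Defs
  imports Complex_Main "HOL-Library.Countable_Set"
begin

datatype ('p, 'a) fm =
    Atom 'p
  | Bot
  | And "('p, 'a) fm" "('p, 'a) fm"
  | Imp "('p, 'a) fm" "('p, 'a) fm"
  | Bel 'a "('p, 'a) fm"

abbreviation Neg :: "('p, 'a) fm \<Rightarrow> ('p, 'a) fm" where
  "Neg \<phi> \<equiv> Imp \<phi> Bot"

record ('p, 'a, 'w) egl =
  worlds :: "'w set"
  acc :: "'a \<Rightarrow> 'w \<Rightarrow> 'w \<Rightarrow> real"
  valu :: "'w \<Rightarrow> 'p \<Rightarrow> real"

definition egl_model :: "('p, 'a, 'w) egl \<Rightarrow> bool" where
  "egl_model M \<longleftrightarrow>
     worlds M \<noteq> {} \<and> countable (worlds M) \<and>
     (\<forall>a. \<forall>s\<in>worlds M. \<forall>s'\<in>worlds M. 0 \<le> acc M a s s' \<and> acc M a s s' \<le> 1) \<and>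
     (\<forall>s\<in>worlds M. \<forall>p. 0 \<le> valu M s p \<and> valu M s p \<le> 1)"

definition goedel_imp :: "real \<Rightarrow> real \<Rightarrow> real" where
  "goedel_imp x y = (if x \<le> y then 1 else y)"

fun val :: "('p, 'a, 'w) egl \<Rightarrow> 'w \<Rightarrow> ('p, 'a) fm \<Rightarrow> real" where
  "val M s (Atom p) = valu M s p"
| "val M s Bot = 0"
| "val M s (And \<phi> \<psi>) = min (val M s \<phi>) (val M s \<psi>)"
| "val M s (Imp \<phi> \<psi>) = goedel_imp (val M s \<phi>) (val M s \<psi>)"
| "val M s (Bel a \<phi>) = (INF s'\<in>worlds M. max (1 - acc M a s s') (val M s' \<phi>))"

definition true_in :: "('p, 'a, 'w) egl \<Rightarrow> ('p, 'a) fm \<Rightarrow> bool" where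
  "true_in M \<phi> \<longleftrightarrow> (\<forall>s\<in>worlds M. val M s \<phi> = 1)"

definition egl_serial :: "('p, 'a, 'w) egl \<Rightarrow> bool" where
  "egl_serial M \<longleftrightarrow> (\<forall>a. \<forall>s\<in>worlds M. \<exists>s'\<in>worlds M. acc M a s s' = 1)"

definition egl_reflexive :: "('p, 'a, 'w) egl \<Rightarrow> bool" where
  "egl_reflexive M \<longleftrightarrow> (\<forall>a. \<forall>s\<in>worlds M. acc M a s s = 1)"

definition egl_transitive :: "('p, 'a, 'w) egl \<Rightarrow> bool" where
  "egl_transitive M \<longleftrightarrow>
     (\<forall>a. \<forall>s\<in>worlds M. \<forall>s'\<in>worlds M. \<forall>s''\<in>worlds M.
        acc M a s s'' \<ge> min (acc M a s s') (acc M a s' s''))"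

text \<open>
  Every model has a countable set of worlds, so up to isomorphism its worlds are natural
  numbers; the classes of models below are therefore taken over the world type nat, which
  contains both the finite and the infinite models.
\<close>

definition serial_transitive_models :: "('p, 'a, nat) egl set" where
  "serial_transitive_models = {M. egl_model M \<and> egl_serial M \<and> egl_transitive M}"

definition serial_transitive_reflexive_models :: "('p, 'a, nat) egl set" where
  "serial_transitive_reflexive_models =
     {M. egl_model M \<and> egl_serial M \<and> egl_transitive M \<and> egl_reflexive M}"

definition valid_in :: "('p, 'a, 'w) egl set \<Rightarrow> ('p, 'a) fm \<Rightarrow> bool" where
  "valid_in C \<phi> \<longleftrightarrow> (\<forall>M\<in>C. true_in M \<phi>)"

text \<open>
  Propositional Goedel logic, over a countably infinite supply of propositional variables,
  with its standard semantics on the unit interval.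
\<close>

datatype gprop = GVar nat | GBot | GAnd gprop gprop | GImp gprop gprop

primrec gval :: "(nat \<Rightarrow> real) \<Rightarrow> gprop \<Rightarrow> real" where
  "gval v (GVar n) = v n"
| "gval v GBot = 0"
| "gval v (GAnd A B) = min (gval v A) (gval v B)"
| "gval v (GImp A B) = goedel_imp (gval v A) (gval v B)"

definition goedel_tautology :: "gprop \<Rightarrow> bool" where
  "goedel_tautology A \<longleftrightarrow> (\<forall>v. (\<forall>n. 0 \<le> v n \<and> v n \<le> 1) \<longrightarrow> gval v A = 1)"

primrec ginst :: "(nat \<Rightarrow> ('p, 'a) fm) \<Rightarrow> gprop \<Rightarrow> ('p, 'a) fm" where
  "ginst \<sigma> (GVar n) = \<sigma> n"
| "ginst \<sigma> GBot = Bot"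
| "ginst \<sigma> (GAnd A B) = And (ginst \<sigma> A) (ginst \<sigma> B)"
| "ginst \<sigma> (GImp A B) = Imp (ginst \<sigma> A) (ginst \<sigma> B)"

definition ax_A :: "('p, 'a) fm set" where
  "ax_A = {ginst \<sigma> A | \<sigma> A. goedel_tautology A}"

definition ax_K :: "('p, 'a) fm set" where
  "ax_K = {Imp (Bel a (Imp \<phi> \<psi>)) (Imp (Bel a \<phi>) (Bel a \<psi>)) | a \<phi> \<psi>. True}"

definition ax_D :: "('p, 'a) fm set" where
  "ax_D = {Neg (Bel a Bot) | a. True}"

definition ax_4 :: "('p, 'a) fm set" where
  "ax_4 = {Imp (Bel a \<phi>) (Bel a (Bel a \<phi>)) | a \<phi>. True}"

definition ax_T :: "('p, 'a) fm set" where
  "ax_T = {Imp (Bel a \<phi>) \<phi> | a \<phi>. True}"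

definition KF_axioms :: "('p, 'a) fm set" where
  "KF_axioms = ax_A \<union> ax_K"

definition BF_axioms :: "('p, 'a) fm set" where
  "BF_axioms = KF_axioms \<union> ax_D \<union> ax_4"

definition TF_axioms :: "('p, 'a) fm set" where
  "TF_axioms = BF_axioms \<union> ax_T"

text \<open>
  The side condition of (R2) excludes its application to non-valid formulas.  Validity is
  understood relative to the class \<open>C\<close> of models for which the axiom system is intended.
  With validity over all models regardless of the system, (R2) could not be applied to
  the axioms (D), (4) and (T), and for instance \<open>Bel a (Neg (Bel a Bot))\<close>, which is true in
  every serial model, would be underivable.
\<close>

definition derivation ::
  "('p, 'a) fm set \<Rightarrow> ('p, 'a, 'w) egl set \<Rightarrow> ('p, 'a) fm list \<Rightarrow> bool" where
  "derivation Ax C xs \<longleftrightarrow>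
     (\<forall>i<length xs.
        xs ! i \<in> Ax \<or>
        (\<exists>j<i. \<exists>k<i. xs ! k = Imp (xs ! j) (xs ! i)) \<or>
        (\<exists>j<i. \<exists>a. xs ! i = Bel a (xs ! j) \<and> valid_in C (xs ! j)))"

definition derivable ::
  "('p, 'a) fm set \<Rightarrow> ('p, 'a, 'w) egl set \<Rightarrow> ('p, 'a) fm \<Rightarrow> bool" where
  "derivable Ax C \<phi> \<longleftrightarrow> (\<exists>xs. xs \<noteq> [] \<and> last xs = \<phi> \<and> derivation Ax C xs)"

definition BF_derivable :: "('p, 'a) fm \<Rightarrow> bool" where
  "BF_derivable \<phi> \<longleftrightarrow> derivable BF_axioms serial_transitive_models \<phi>"

definition TF_derivable :: "('p, 'a) fm \<Rightarrow> bool" where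
  "TF_derivable \<phi> \<longleftrightarrow> derivable TF_axioms serial_transitive_reflexive_models \<phi>"

end

theory Submission
  imports Defs
begin

text \<open>
  By soundness, every derivable formula is valid in the intended class, so (R2) is in effect
  unrestricted and a canonical model argument applies. Since the axioms (A) are given semantically,
  an implication \<open>\<gamma> \<longrightarrow> \<psi>\<close> that is underivable from finitely many theorems fails under a Goedel
  valuation of all formulas that satisfies these theorems. Points are the valuations satisfying
  the finitely many derivable sequents over a finite fragment. A point \<open>u\<close> with \<open>u (Bel a \<psi>) = \<alpha> < 1\<close>
  needs points \<open>v\<close> accessible to degree at least \<open>1 - \<alpha>\<close> with \<open>v \<psi>\<close> arbitrarily small: it suffices
  that \<open>v\<close> makes true all \<open>\<chi>\<close> and \<open>Bel a \<chi>\<close> with \<open>u (Bel a \<chi>) > \<alpha>\<close>, and such \<open>v\<close> exist by (K) and (4).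
  As infinitely many witnesses are needed, countability of the model is obtained by closing a
  single point under a choice of witnesses.
\<close>

section \<open>Soundness\<close>

lemma goedel_imp_bounds: "0 \<le> y \<Longrightarrow> y \<le> 1 \<Longrightarrow> 0 \<le> goedel_imp x y \<and> goedel_imp x y \<le> 1"
  by (simp add: goedel_imp_def)

lemma goedel_imp_eq_1_iff: "x \<le> 1 \<Longrightarrow> goedel_imp x y = 1 \<longleftrightarrow> x \<le> y"
  by (auto simp: goedel_imp_def)

lemma le_goedel_imp_iff: "z \<le> 1 \<Longrightarrow> z \<le> goedel_imp x y \<longleftrightarrow> min z x \<le> y"
  by (auto simp: goedel_imp_def)

context
  fixes M :: "('p, 'a, 'w) egl"
  assumes M: "egl_model M"
begin

lemma acc_bounds:
  "s \<in> worlds M \<Longrightarrow> s' \<in> worlds M \<Longrightarrow> 0 \<le> acc M a s s' \<and> acc M a s s' \<le> 1"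
  using M by (auto simp: egl_model_def)

lemma le_val_Bel:
  assumes "\<And>s'. s' \<in> worlds M \<Longrightarrow> c \<le> max (1 - acc M a s s') (val M s' \<phi>)"
  shows "c \<le> val M s (Bel a \<phi>)"
  using assms M by (auto simp: egl_model_def intro!: cINF_greatest)

lemma val_Bel_le:
  assumes "s \<in> worlds M" "s' \<in> worlds M"
  shows "val M s (Bel a \<phi>) \<le> max (1 - acc M a s s') (val M s' \<phi>)"
proof -
  have "bdd_below ((\<lambda>t. max (1 - acc M a s t) (val M t \<phi>)) ` worlds M)"
    using acc_bounds[OF assms(1), of _ a] by (intro bdd_belowI2[where m = 0]) (simp add: le_max_iff_disj)
  then show ?thesis
    using cINF_lower[OF _ assms(2)] by fastforce
qed

lemma val_bounds: "s \<in> worlds M \<Longrightarrow> 0 \<le> val M s \<phi> \<and> val M s \<phi> \<le> 1"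
proof (induction \<phi> arbitrary: s)
  case (Atom p)
  then show ?case using M by (auto simp: egl_model_def)
next
  case (Imp \<phi> \<psi>)
  then show ?case by (simp add: goedel_imp_bounds)
next
  case (Bel a \<phi>)
  have "0 \<le> val M s (Bel a \<phi>)"
    by (rule le_val_Bel) (simp add: Bel.IH le_max_iff_disj)
  moreover have "val M s (Bel a \<phi>) \<le> 1"
    using val_Bel_le[OF Bel.prems Bel.prems, of a \<phi>] Bel.IH[OF Bel.prems] acc_bounds[OF Bel.prems Bel.prems, of a]
    by linarith
  ultimately show ?case by blast
qed (auto simp: min_le_iff_disj)

lemma val_Imp_eq_1_iff:
  "s \<in> worlds M \<Longrightarrow> val M s (Imp \<phi> \<psi>) = 1 \<longleftrightarrow> val M s \<phi> \<le> val M s \<psi>"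
  by (simp add: goedel_imp_eq_1_iff val_bounds)

lemma true_in_Imp:
  "(\<And>s. s \<in> worlds M \<Longrightarrow> val M s \<phi> \<le> val M s \<psi>) \<Longrightarrow> true_in M (Imp \<phi> \<psi>)"
  using val_Imp_eq_1_iff unfolding true_in_def by blast

lemma val_ginst: "val M s (ginst \<sigma> A) = gval (\<lambda>n. val M s (\<sigma> n)) A"
  by (induction A) auto

lemma ax_A_sound: "\<phi> \<in> ax_A \<Longrightarrow> true_in M \<phi>"
  by (auto simp: ax_A_def true_in_def goedel_tautology_def val_ginst val_bounds)

lemma ax_K_sound:
  assumes "\<phi> \<in> ax_K"
  shows "true_in M \<phi>"
proof -
  obtain a \<alpha> \<beta> where \<phi>: "\<phi> = Imp (Bel a (Imp \<alpha> \<beta>)) (Imp (Bel a \<alpha>) (Bel a \<beta>))"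
    using assms by (auto simp: ax_K_def)
  have "val M s (Bel a (Imp \<alpha> \<beta>)) \<le> val M s (Imp (Bel a \<alpha>) (Bel a \<beta>))" if s: "s \<in> worlds M" for s
  proof -
    have "min (val M s (Bel a (Imp \<alpha> \<beta>))) (val M s (Bel a \<alpha>)) \<le> val M s (Bel a \<beta>)"
    proof (rule le_val_Bel)
      fix s' assume s': "s' \<in> worlds M"
      have "min (val M s' (Imp \<alpha> \<beta>)) (val M s' \<alpha>) \<le> val M s' \<beta>"
        by (auto simp: goedel_imp_def)
      then show "min (val M s (Bel a (Imp \<alpha> \<beta>))) (val M s (Bel a \<alpha>)) \<le> max (1 - acc M a s s') (val M s' \<beta>)"
        using val_Bel_le[OF s s', of a "Imp \<alpha> \<beta>"] val_Bel_le[OF s s', of a \<alpha>] by linarith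
    qed
    then show ?thesis
      using val_bounds[OF s] by (simp only: val.simps(4) le_goedel_imp_iff)
  qed
  then show ?thesis
    unfolding \<phi> by (rule true_in_Imp)
qed

lemma ax_D_sound:
  assumes "egl_serial M" "\<phi> \<in> ax_D"
  shows "true_in M \<phi>"
proof -
  obtain a where \<phi>: "\<phi> = Neg (Bel a Bot)"
    using assms by (auto simp: ax_D_def)
  have "val M s (Bel a Bot) \<le> val M s Bot" if s: "s \<in> worlds M" for s
  proof -
    obtain s' where "s' \<in> worlds M" "acc M a s s' = 1"
      using assms s by (auto simp: egl_serial_def)
    then show ?thesis
      using val_Bel_le[OF s, of s' a Bot] by (simp del: val.simps(5))
  qed
  then show ?thesis
    unfolding \<phi> by (rule true_in_Imp)
qed

lemma ax_4_sound:
  assumes "egl_transitive M" "\<phi> \<in> ax_4"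
  shows "true_in M \<phi>"
proof -
  obtain a \<alpha> where \<phi>: "\<phi> = Imp (Bel a \<alpha>) (Bel a (Bel a \<alpha>))"
    using assms by (auto simp: ax_4_def)
  have "val M s (Bel a \<alpha>) \<le> val M s (Bel a (Bel a \<alpha>))" if s: "s \<in> worlds M" for s
  proof (rule le_val_Bel)
    fix s' assume s': "s' \<in> worlds M"
    show "val M s (Bel a \<alpha>) \<le> max (1 - acc M a s s') (val M s' (Bel a \<alpha>))"
    proof (cases "val M s (Bel a \<alpha>) \<le> 1 - acc M a s s'")
      case False
      have "val M s (Bel a \<alpha>) \<le> val M s' (Bel a \<alpha>)"
      proof (rule le_val_Bel)
        fix s'' assume s'': "s'' \<in> worlds M"
        have "acc M a s s'' \<ge> min (acc M a s s') (acc M a s' s'')"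
          using assms s s' s'' by (auto simp: egl_transitive_def)
        then show "val M s (Bel a \<alpha>) \<le> max (1 - acc M a s' s'') (val M s'' \<alpha>)"
          using val_Bel_le[OF s s'', of a \<alpha>] False by linarith
      qed
      then show ?thesis by linarith
    qed simp
  qed
  then show ?thesis
    unfolding \<phi> by (rule true_in_Imp)
qed

lemma ax_T_sound:
  assumes "egl_reflexive M" "\<phi> \<in> ax_T"
  shows "true_in M \<phi>"
proof -
  obtain a \<alpha> where \<phi>: "\<phi> = Imp (Bel a \<alpha>) \<alpha>"
    using assms by (auto simp: ax_T_def)
  have "val M s (Bel a \<alpha>) \<le> val M s \<alpha>" if s: "s \<in> worlds M" for s
    using val_Bel_le[OF s s, of a \<alpha>] val_bounds[OF s, of \<alpha>] assms s
    by (simp add: egl_reflexive_def del: val.simps)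
  then show ?thesis
    unfolding \<phi> by (rule true_in_Imp)
qed

lemma true_in_mp:
  assumes "true_in M (Imp \<phi> \<psi>)" "true_in M \<phi>"
  shows "true_in M \<psi>"
  unfolding true_in_def
proof
  fix s assume s: "s \<in> worlds M"
  have "val M s \<phi> \<le> val M s \<psi>" "val M s \<phi> = 1"
    using assms s val_Imp_eq_1_iff[OF s, of \<phi> \<psi>] by (auto simp: true_in_def)
  then show "val M s \<psi> = 1"
    using val_bounds[OF s, of \<psi>] by simp
qed

lemma true_in_nec:
  assumes "true_in M \<phi>"
  shows "true_in M (Bel a \<phi>)"
  unfolding true_in_def
proof
  fix s assume s: "s \<in> worlds M"
  have "1 \<le> val M s (Bel a \<phi>)"
    by (rule le_val_Bel) (use assms in \<open>simp add: true_in_def\<close>)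
  then show "val M s (Bel a \<phi>) = 1"
    using val_bounds[OF s, of "Bel a \<phi>"] by simp
qed

end

lemma derivation_sound:
  assumes "derivation Ax C xs" "\<And>M. M \<in> C \<Longrightarrow> egl_model M" "\<And>\<phi>. \<phi> \<in> Ax \<Longrightarrow> valid_in C \<phi>"
  shows "i < length xs \<Longrightarrow> valid_in C (xs ! i)"
proof (induction i rule: less_induct)
  case (less i)
  consider "xs ! i \<in> Ax" | j k where "j < i" "k < i" "xs ! k = Imp (xs ! j) (xs ! i)"
    | j a where "j < i" "xs ! i = Bel a (xs ! j)"
    using assms(1) less.prems unfolding derivation_def by blast
  then show ?case
  proof cases
    case 1
    then show ?thesis by (rule assms(3))
  next
    case 2
    then have "valid_in C (Imp (xs ! j) (xs ! i))" "valid_in C (xs ! j)"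
      using less.IH[of k] less.IH[of j] less.prems by auto
    then show ?thesis
      using true_in_mp assms(2) unfolding valid_in_def by blast
  next
    case 3
    then have "valid_in C (xs ! j)"
      using less by auto
    then show ?thesis
      using true_in_nec assms(2) 3 unfolding valid_in_def by metis
  qed
qed

lemma derivable_sound:
  assumes "derivable Ax C \<phi>" "\<And>M. M \<in> C \<Longrightarrow> egl_model M" "\<And>\<phi>. \<phi> \<in> Ax \<Longrightarrow> valid_in C \<phi>"
  shows "valid_in C \<phi>"
proof -
  obtain xs where xs: "xs \<noteq> []" "last xs = \<phi>" "derivation Ax C xs"
    using assms(1) by (auto simp: derivable_def)
  then show ?thesis
    using derivation_sound[OF xs(3) assms(2,3), of "length xs - 1"] by (simp add: last_conv_nth)
qed

section \<open>Closure properties of derivability\<close>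

definition inference ::
  "('p, 'a) fm set \<Rightarrow> ('p, 'a, 'w) egl set \<Rightarrow> ('p, 'a) fm set \<Rightarrow> ('p, 'a) fm \<Rightarrow> bool" where
  "inference Ax C X \<phi> \<longleftrightarrow>
     \<phi> \<in> Ax \<or> (\<exists>\<psi>\<in>X. \<exists>\<chi>\<in>X. \<chi> = Imp \<psi> \<phi>) \<or> (\<exists>\<psi>\<in>X. \<exists>a. \<phi> = Bel a \<psi> \<and> valid_in C \<psi>)"

lemma inference_mono: "inference Ax C X \<phi> \<Longrightarrow> X \<subseteq> Y \<Longrightarrow> inference Ax C Y \<phi>"
  unfolding inference_def by blast

lemma derivation_iff_inference:
  "derivation Ax C xs \<longleftrightarrow> (\<forall>i<length xs. inference Ax C (set (take i xs)) (xs ! i))"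
proof -
  have "(xs ! i \<in> Ax \<or> (\<exists>j<i. \<exists>k<i. xs ! k = Imp (xs ! j) (xs ! i)) \<or>
      (\<exists>j<i. \<exists>a. xs ! i = Bel a (xs ! j) \<and> valid_in C (xs ! j))) \<longleftrightarrow>
    inference Ax C (set (take i xs)) (xs ! i)" if "i < length xs" for i
  proof -
    have set_take: "set (take i xs) = (!) xs ` {..<i}"
      using that by (simp add: nth_image[symmetric] lessThan_atLeast0)
    show ?thesis
      unfolding inference_def set_take bex_simps Bex_def lessThan_iff by blast
  qed
  then show ?thesis
    unfolding derivation_def by blast
qed

lemma derivation_Nil: "derivation Ax C []"
  by (simp add: derivation_def)

lemma derivation_snoc:
  "derivation Ax C (xs @ [\<phi>]) \<longleftrightarrow> derivation Ax C xs \<and> inference Ax C (set xs) \<phi>"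
  by (auto simp: derivation_iff_inference less_Suc_eq nth_append)

lemma derivation_append:
  "derivation Ax C xs \<Longrightarrow> derivation Ax C ys \<Longrightarrow> derivation Ax C (xs @ ys)"
proof (induction ys rule: rev_induct)
  case (snoc y ys)
  then show ?case
    using inference_mono[of Ax C "set ys" y "set (xs @ ys)"]
    by (simp add: derivation_snoc flip: append_assoc)
qed simp

lemma derivable_if_inference:
  "derivation Ax C xs \<Longrightarrow> inference Ax C (set xs) \<phi> \<Longrightarrow> derivable Ax C \<phi>"
  unfolding derivable_def by (intro exI[of _ "xs @ [\<phi>]"]) (simp add: derivation_snoc)

lemma derivableE:
  assumes "derivable Ax C \<phi>"
  obtains xs where "derivation Ax C xs" "\<phi> \<in> set xs"
  using assms unfolding derivable_def by auto

lemma derivable_axiom: "\<phi> \<in> Ax \<Longrightarrow> derivable Ax C \<phi>"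
  by (rule derivable_if_inference[OF derivation_Nil]) (simp add: inference_def)

lemma derivable_mp:
  assumes "derivable Ax C (Imp \<phi> \<psi>)" "derivable Ax C \<phi>"
  shows "derivable Ax C \<psi>"
proof -
  obtain xs ys where "derivation Ax C xs" "Imp \<phi> \<psi> \<in> set xs" "derivation Ax C ys" "\<phi> \<in> set ys"
    using assms by (blast elim: derivableE)
  then have "derivation Ax C (xs @ ys)" "inference Ax C (set (xs @ ys)) \<psi>"
    by (auto simp: derivation_append inference_def)
  then show ?thesis
    by (rule derivable_if_inference)
qed

lemma derivable_nec:
  assumes "derivable Ax C \<phi>" "valid_in C \<phi>"
  shows "derivable Ax C (Bel a \<phi>)"
  using assms by (elim derivableE, intro derivable_if_inference) (auto simp: inference_def)

section \<open>Goedel valuations of modal formulas\<close>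

definition goedel_valuation :: "(('p, 'a) fm \<Rightarrow> real) \<Rightarrow> bool" where
  "goedel_valuation v \<longleftrightarrow>
     (\<forall>\<phi>. 0 \<le> v \<phi> \<and> v \<phi> \<le> 1) \<and> v Bot = 0 \<and>
     (\<forall>\<phi> \<psi>. v (And \<phi> \<psi>) = min (v \<phi>) (v \<psi>)) \<and>
     (\<forall>\<phi> \<psi>. v (Imp \<phi> \<psi>) = goedel_imp (v \<phi>) (v \<psi>))"

lemma goedel_valuationD:
  assumes "goedel_valuation v"
  shows "0 \<le> v \<phi>" "v \<phi> \<le> 1" "v Bot = 0" "v (And \<phi> \<psi>) = min (v \<phi>) (v \<psi>)"
    "v (Imp \<phi> \<psi>) = goedel_imp (v \<phi>) (v \<psi>)"
  using assms by (auto simp: goedel_valuation_def)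

lemma goedel_valuation_Imp_eq_1_iff:
  "goedel_valuation v \<Longrightarrow> v (Imp \<phi> \<psi>) = 1 \<longleftrightarrow> v \<phi> \<le> v \<psi>"
  by (simp add: goedel_valuationD goedel_imp_eq_1_iff)

text \<open>
  The threshold \<open>m\<close> turns a valuation that violates an implication into one that makes its premise
  true; the factor \<open>\<epsilon>\<close> is what lets the infima in the canonical model reach their intended value.
\<close>

lemma goedel_valuation_rescale:
  fixes m \<epsilon> :: real
  assumes v: "goedel_valuation v" and "0 < m" "m \<le> 1" "0 < \<epsilon>" "\<epsilon> \<le> 1"
  shows "goedel_valuation (\<lambda>\<phi>. if m \<le> v \<phi> then 1 else \<epsilon> * v \<phi>)"
proof -
  define g where "g x = (if m \<le> x then 1 else \<epsilon> * x)" for x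
  have small: "\<epsilon> * x < 1" if "x < m" "0 \<le> x" for x
    using mult_right_mono[of \<epsilon> 1 x] assms that by linarith
  have bounds: "0 \<le> g x \<and> g x \<le> 1" if "0 \<le> x" for x
    using small[of x] assms that by (auto simp: g_def)
  have mono: "g x \<le> g y" if "x \<le> y" "0 \<le> x" for x y
    using small[of x] assms that by (auto simp: g_def)
  have min: "g (min x y) = min (g x) (g y)" if "0 \<le> x" "0 \<le> y" for x y
    using mono[of x y] mono[of y x] that by (auto simp: min_def)
  have imp: "g (goedel_imp x y) = goedel_imp (g x) (g y)" if "0 \<le> x" "0 \<le> y" for x y
  proof (cases "x \<le> y")
    case True
    then show ?thesis
      using mono[of x y] that assms by (simp add: goedel_imp_def) (simp add: g_def)
  next
    case False
    then have "g y < g x \<or> g y = 1"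
      using small[of y] assms that by (auto simp: g_def)
    then show ?thesis
      using False bounds[of x] that by (auto simp: goedel_imp_def)
  qed
  have "goedel_valuation (\<lambda>\<phi>. g (v \<phi>))"
    using v bounds min imp assms by (simp add: goedel_valuation_def) (simp add: g_def)
  then show ?thesis
    by (simp add: g_def)
qed

primrec Conj :: "('p, 'a) fm list \<Rightarrow> ('p, 'a) fm" where
  "Conj [] = Imp Bot Bot"
| "Conj (\<phi> # \<phi>s) = And \<phi> (Conj \<phi>s)"

lemma le_goedel_valuation_Conj_iff:
  "goedel_valuation v \<Longrightarrow> c \<le> v (Conj xs) \<longleftrightarrow> c \<le> 1 \<and> (\<forall>x\<in>set xs. c \<le> v x)"
  by (induction xs) (auto simp: goedel_valuationD goedel_imp_def)

primrec primes :: "('p, 'a) fm \<Rightarrow> ('p, 'a) fm set" where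
  "primes (Atom p) = {Atom p}"
| "primes Bot = {}"
| "primes (And \<phi> \<psi>) = primes \<phi> \<union> primes \<psi>"
| "primes (Imp \<phi> \<psi>) = primes \<phi> \<union> primes \<psi>"
| "primes (Bel a \<phi>) = {Bel a \<phi>}"

lemma finite_primes: "finite (primes \<phi>)"
  by (induction \<phi>) auto

primrec skeleton :: "(('p, 'a) fm \<Rightarrow> nat) \<Rightarrow> ('p, 'a) fm \<Rightarrow> gprop" where
  "skeleton f (Atom p) = GVar (f (Atom p))"
| "skeleton f Bot = GBot"
| "skeleton f (And \<phi> \<psi>) = GAnd (skeleton f \<phi>) (skeleton f \<psi>)"
| "skeleton f (Imp \<phi> \<psi>) = GImp (skeleton f \<phi>) (skeleton f \<psi>)"
| "skeleton f (Bel a \<phi>) = GVar (f (Bel a \<phi>))"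

lemma ginst_skeleton: "(\<And>\<chi>. \<chi> \<in> primes \<phi> \<Longrightarrow> \<sigma> (f \<chi>) = \<chi>) \<Longrightarrow> ginst \<sigma> (skeleton f \<phi>) = \<phi>"
  by (induction \<phi>) auto

lemma gval_bounds: "(\<And>n. 0 \<le> w n \<and> w n \<le> 1) \<Longrightarrow> 0 \<le> gval w A \<and> gval w A \<le> 1"
  by (induction A) (auto simp: goedel_imp_bounds)

lemma goedel_valuation_gval:
  "(\<And>n. 0 \<le> w n \<and> w n \<le> 1) \<Longrightarrow> goedel_valuation (\<lambda>\<phi>. gval w (skeleton f \<phi>))"
  by (simp add: goedel_valuation_def gval_bounds)

lemma ax_A_if_goedel_valid:
  assumes "\<And>v. goedel_valuation v \<Longrightarrow> v \<phi> = 1"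
  shows "\<phi> \<in> ax_A"
proof -
  let ?f = "to_nat_on (primes \<phi>)" and ?\<sigma> = "from_nat_into (primes \<phi>)"
  have "ginst ?\<sigma> (skeleton ?f \<phi>) = \<phi>"
    by (rule ginst_skeleton) (simp add: countable_finite finite_primes)
  moreover have "goedel_tautology (skeleton ?f \<phi>)"
    unfolding goedel_tautology_def using assms[OF goedel_valuation_gval] by blast
  ultimately show ?thesis
    unfolding ax_A_def by (metis (mono_tags, lifting) mem_Collect_eq)
qed

section \<open>Derived rules\<close>

locale belief_logic =
  fixes D :: "('p, 'a) fm \<Rightarrow> bool"
  assumes A: "\<phi> \<in> ax_A \<Longrightarrow> D \<phi>"
    and K: "D (Imp (Bel a (Imp \<phi> \<psi>)) (Imp (Bel a \<phi>) (Bel a \<psi>)))"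
    and consistency: "D (Neg (Bel a Bot))"
    and positive_introspection: "D (Imp (Bel a \<phi>) (Bel a (Bel a \<phi>)))"
    and mp: "D (Imp \<phi> \<psi>) \<Longrightarrow> D \<phi> \<Longrightarrow> D \<psi>"
    and nec: "D \<phi> \<Longrightarrow> D (Bel a \<phi>)"
begin

lemma D_Imp_if_le: "(\<And>v. goedel_valuation v \<Longrightarrow> v \<phi> \<le> v \<psi>) \<Longrightarrow> D (Imp \<phi> \<psi>)"
  by (rule A, rule ax_A_if_goedel_valid) (simp add: goedel_valuation_Imp_eq_1_iff)

lemma Imp_trans:
  assumes "D (Imp \<phi> \<psi>)" "D (Imp \<psi> \<chi>)"
  shows "D (Imp \<phi> \<chi>)"
proof -
  have "D (Imp (Imp \<phi> \<psi>) (Imp (Imp \<psi> \<chi>) (Imp \<phi> \<chi>)))"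
    by (rule D_Imp_if_le) (auto simp: goedel_valuationD goedel_imp_def)
  then show ?thesis using assms mp by blast
qed

lemma Imp_weaken: "D \<psi> \<Longrightarrow> D (Imp \<phi> \<psi>)"
  by (rule mp[of \<psi>]) (rule D_Imp_if_le, auto simp: goedel_valuationD goedel_imp_def)

lemma Imp_And:
  assumes "D (Imp \<phi> \<psi>)" "D (Imp \<phi> \<chi>)"
  shows "D (Imp \<phi> (And \<psi> \<chi>))"
proof -
  have "D (Imp (Imp \<phi> \<psi>) (Imp (Imp \<phi> \<chi>) (Imp \<phi> (And \<psi> \<chi>))))"
    by (rule D_Imp_if_le) (auto simp: goedel_valuationD goedel_imp_def)
  then show ?thesis using assms mp by blast
qed

lemma Imp_mp:
  assumes "D (Imp \<phi> (Imp \<psi> \<chi>))" "D (Imp \<phi> \<psi>)"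
  shows "D (Imp \<phi> \<chi>)"
proof -
  have "D (Imp (Imp \<phi> (Imp \<psi> \<chi>)) (Imp (Imp \<phi> \<psi>) (Imp \<phi> \<chi>)))"
    by (rule D_Imp_if_le) (auto simp: goedel_valuationD goedel_imp_def)
  then show ?thesis using assms mp by blast
qed

lemma Imp_Conj: "(\<And>x. x \<in> set xs \<Longrightarrow> D (Imp \<phi> x)) \<Longrightarrow> D (Imp \<phi> (Conj xs))"
proof (induction xs)
  case Nil
  show ?case by (rule D_Imp_if_le) (simp add: goedel_valuationD goedel_imp_def)
qed (simp add: Imp_And)

lemma Conj_Imp: "x \<in> set xs \<Longrightarrow> D (Imp (Conj xs) x)"
  by (rule D_Imp_if_le) (metis le_goedel_valuation_Conj_iff order_refl)

lemma Bel_mono: "D (Imp \<phi> \<psi>) \<Longrightarrow> D (Imp (Bel a \<phi>) (Bel a \<psi>))"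
  using K mp nec by blast

lemma Bel_Conj: "D (Imp (Conj (map (Bel a) xs)) (Bel a (Conj xs)))"
proof (induction xs)
  case Nil
  have "D (Conj [])"
    by (rule A, rule ax_A_if_goedel_valid) (simp add: goedel_valuationD goedel_imp_def)
  then show ?case by (simp add: Imp_weaken nec)
next
  case (Cons x xs)
  let ?c = "Conj (map (Bel a) (x # xs))"
  have "D (Imp x (Imp (Conj xs) (And x (Conj xs))))"
    by (rule D_Imp_if_le) (auto simp: goedel_valuationD goedel_imp_def)
  then have "D (Imp (Bel a x) (Imp (Bel a (Conj xs)) (Bel a (And x (Conj xs)))))"
    using Bel_mono K Imp_trans by blast
  moreover have "D (Imp ?c (Bel a x))"
    by (rule Conj_Imp) simp
  moreover have "D (Imp ?c (Conj (map (Bel a) xs)))"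
    by (rule D_Imp_if_le) (simp add: goedel_valuationD)
  ultimately have "D (Imp ?c (Bel a (And x (Conj xs))))"
    using Cons.IH Imp_trans[of ?c] Imp_mp[of ?c "Bel a (Conj xs)"] by blast
  then show ?case by simp
qed

lemma Bel_Conj_Imp:
  assumes "D (Imp (Conj (xs @ map (Bel a) xs)) \<psi>)"
  shows "D (Imp (Conj (map (Bel a) xs)) (Bel a \<psi>))"
proof -
  let ?c = "Conj (map (Bel a) xs)"
  have "D (Imp ?c (Conj (map (Bel a) (xs @ map (Bel a) xs))))"
  proof (rule Imp_Conj)
    fix y assume "y \<in> set (map (Bel a) (xs @ map (Bel a) xs))"
    then obtain x where x: "x \<in> set xs" "y = Bel a x \<or> y = Bel a (Bel a x)"
      by auto
    have "D (Imp ?c (Bel a x))"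
      using x by (intro Conj_Imp) simp
    then show "D (Imp ?c y)"
      using x(2) positive_introspection Imp_trans by blast
  qed
  then show ?thesis
    using Bel_Conj Bel_mono[OF assms] Imp_trans by blast
qed

lemma ex_valuation_if_not_D:
  fixes \<epsilon> :: real
  assumes "\<not> D (Imp (Conj xs) \<psi>)" "\<And>\<theta>. \<theta> \<in> set ts \<Longrightarrow> D \<theta>" "0 < \<epsilon>" "\<epsilon> \<le> 1"
  shows "\<exists>v. goedel_valuation v \<and> (\<forall>\<theta>\<in>set ts. v \<theta> = 1) \<and> (\<forall>x\<in>set xs. v x = 1) \<and> v \<psi> < 1 \<and> v \<psi> \<le> \<epsilon>"
proof -
  have "D (Imp (Conj xs) (Conj (xs @ ts)))"
    by (rule Imp_Conj) (use assms(2) Conj_Imp Imp_weaken in auto)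
  then have "\<not> D (Imp (Conj (xs @ ts)) \<psi>)"
    using assms(1) Imp_trans by blast
  then obtain v where v: "goedel_valuation v" "v \<psi> < v (Conj (xs @ ts))"
    using D_Imp_if_le not_less by blast
  define m where "m = v (Conj (xs @ ts))"
  have m: "0 < m" "m \<le> 1"
    using v goedel_valuationD[OF v(1)] by (auto simp: m_def intro: le_less_trans)
  have le: "m \<le> v x" if "x \<in> set (xs @ ts)" for x
    using le_goedel_valuation_Conj_iff[OF v(1), of m "xs @ ts"] that by (simp add: m_def)
  have "\<epsilon> * v \<psi> < 1" "\<epsilon> * v \<psi> \<le> \<epsilon>"
    using v m assms(3,4) mult_right_mono[of \<epsilon> 1 "v \<psi>"] mult_left_mono[of "v \<psi>" 1 \<epsilon>]
      goedel_valuationD(1,2)[OF v(1), of \<psi>] by (auto simp: m_def)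
  then show ?thesis
    using goedel_valuation_rescale[OF v(1) m assms(3,4)] le v(2)
    by (intro exI[of _ "\<lambda>\<phi>. if m \<le> v \<phi> then 1 else \<epsilon> * v \<phi>"]) (auto simp: m_def)
qed

end

section \<open>The canonical model of a finite fragment\<close>

text \<open>A downward Loewenheim-Skolem argument.\<close>

lemma countable_closure:
  fixes R :: "'i::countable \<Rightarrow> 'x \<Rightarrow> 'x \<Rightarrow> bool"
  assumes "x0 \<in> X" and step: "\<And>i x. x \<in> X \<Longrightarrow> \<exists>y\<in>X. R i x y"
  shows "\<exists>h :: nat \<Rightarrow> 'x. range h \<subseteq> X \<and> x0 \<in> range h \<and> (\<forall>m i. \<exists>k. R i (h m) (h k))"
proof -
  define f where "f i x = (SOME y. y \<in> X \<and> R i x y)" for i x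
  have f: "f i x \<in> X \<and> R i x (f i x)" if "x \<in> X" for i x
    unfolding f_def by (rule someI_ex) (use step[OF that] in blast)
  define g where "g is = foldr f is x0" for "is"
  have g: "g is \<in> X" for "is"
    by (induction "is") (auto simp: g_def assms(1) f)
  define h where "h n = g (from_nat n)" for n
  have h: "h (to_nat is) = g is" for "is"
    by (simp add: h_def)
  have "R i (h m) (h (to_nat (i # from_nat m)))" for i m
    using f[OF g] by (simp add: h_def g_def)
  moreover have "h (to_nat ([] :: 'i list)) = x0"
    by (simp add: h g_def)
  ultimately show ?thesis
    using g by (metis h_def image_subsetI rangeI)
qed

locale fragment = belief_logic D for D :: "('p, 'a) fm \<Rightarrow> bool" +
  fixes S :: "('p, 'a) fm set"
  assumes finite_S: "finite S"
    and Bot_S: "Bot \<in> S"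
    and And_S: "And \<phi> \<psi> \<in> S \<Longrightarrow> \<phi> \<in> S \<and> \<psi> \<in> S"
    and Imp_S: "Imp \<phi> \<psi> \<in> S \<Longrightarrow> \<phi> \<in> S \<and> \<psi> \<in> S"
    and Bel_S: "Bel a \<phi> \<in> S \<Longrightarrow> \<phi> \<in> S \<and> Bel a Bot \<in> S"
begin

definition sequents :: "('p, 'a) fm set" where
  "sequents = {\<theta>. D \<theta> \<and> (\<exists>xs \<chi>. set xs \<subseteq> S \<and> distinct xs \<and> \<chi> \<in> S \<and> \<theta> = Imp (Conj xs) \<chi>)}"

definition point :: "(('p, 'a) fm \<Rightarrow> real) \<Rightarrow> bool" where
  "point u \<longleftrightarrow> goedel_valuation u \<and> (\<forall>\<theta>\<in>sequents. u \<theta> = 1)"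

text \<open>
  \<open>cost a u v\<close> plays the role of \<open>1 - r\<^sub>a(u,v)\<close>. It is the least \<open>c \<ge> 0\<close> such that
  \<open>u (Bel a \<chi>) \<le> max c (min (v \<chi>) (v (Bel a \<chi>)))\<close> for all \<open>Bel a \<chi>\<close> in the fragment; the
  second argument of \<open>min\<close> makes the relation transitive although the fragment need not
  contain \<open>Bel a (Bel a \<chi>)\<close>.
\<close>

definition cost :: "'a \<Rightarrow> (('p, 'a) fm \<Rightarrow> real) \<Rightarrow> (('p, 'a) fm \<Rightarrow> real) \<Rightarrow> real" where
  "cost a u v =
     Max (insert 0 (u ` {\<beta> \<in> S. \<exists>\<chi>. \<beta> = Bel a \<chi> \<and> min (v \<chi>) (v \<beta>) < u \<beta>}))"

lemma cost_le_iff: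
  "cost a u v \<le> c \<longleftrightarrow>
    0 \<le> c \<and> (\<forall>\<chi>. Bel a \<chi> \<in> S \<longrightarrow> u (Bel a \<chi>) \<le> max c (min (v \<chi>) (v (Bel a \<chi>))))"
  by (auto simp: cost_def finite_S le_max_iff_disj not_less)

lemma cost_nonneg: "0 \<le> cost a u v"
  using cost_le_iff by blast

lemma Bel_le_cost: "Bel a \<chi> \<in> S \<Longrightarrow> u (Bel a \<chi>) \<le> max (cost a u v) (min (v \<chi>) (v (Bel a \<chi>)))"
  using cost_le_iff by blast

lemma finite_sequents: "finite sequents"
proof -
  have "sequents \<subseteq> (\<lambda>(xs, \<chi>). Imp (Conj xs) \<chi>) ` ({xs. set xs \<subseteq> S \<and> distinct xs} \<times> S)"
    by (auto simp: sequents_def)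
  then show ?thesis
    by (rule finite_subset) (simp add: finite_S finite_subset_distinct)
qed

lemma ex_point_if_not_D:
  fixes \<epsilon> :: real
  assumes "\<not> D (Imp (Conj xs) \<psi>)" "0 < \<epsilon>" "\<epsilon> \<le> 1"
  shows "\<exists>v. point v \<and> (\<forall>x\<in>set xs. v x = 1) \<and> v \<psi> < 1 \<and> v \<psi> \<le> \<epsilon>"
proof -
  obtain ts where ts: "set ts = sequents"
    using finite_list[OF finite_sequents] by blast
  then have "D \<theta>" if "\<theta> \<in> set ts" for \<theta>
    using that by (simp add: sequents_def)
  then show ?thesis
    using ex_valuation_if_not_D[OF assms(1) _ assms(2,3), of ts] ts
    by (simp add: point_def conj_assoc)
qed

lemma point_le:
  assumes "point u" "D (Imp (Conj xs) \<chi>)" "set xs \<subseteq> S" "distinct xs" "\<chi> \<in> S"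
  shows "u (Conj xs) \<le> u \<chi>"
proof -
  have "Imp (Conj xs) \<chi> \<in> sequents"
    using assms by (auto simp: sequents_def)
  then show ?thesis
    using assms(1) goedel_valuation_Imp_eq_1_iff unfolding point_def by blast
qed

lemma point_le1:
  assumes "point u" "D (Imp \<beta> \<chi>)" "\<beta> \<in> S" "\<chi> \<in> S"
  shows "u \<beta> \<le> u \<chi>"
proof -
  have u: "goedel_valuation u"
    using assms(1) by (simp add: point_def)
  have "D (Imp (Conj [\<beta>]) \<chi>)"
    using Conj_Imp[of \<beta> "[\<beta>]"] assms(2) Imp_trans by simp
  then have "u (Conj [\<beta>]) \<le> u \<chi>"
    using assms by (intro point_le) auto
  moreover have "u \<beta> \<le> u (Conj [\<beta>])"
    using u by (simp add: goedel_valuationD le_goedel_valuation_Conj_iff del: Conj.simps)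
  ultimately show ?thesis by simp
qed

lemma witness:
  fixes \<epsilon> :: real
  assumes u: "point u" and \<psi>: "Bel a \<psi> \<in> S" "u (Bel a \<psi>) < 1" and \<epsilon>: "0 < \<epsilon>" "\<epsilon> \<le> 1"
  shows "\<exists>v. point v \<and> cost a u v \<le> u (Bel a \<psi>) \<and> v \<psi> \<le> \<epsilon>"
proof -
  let ?\<alpha> = "u (Bel a \<psi>)"
  have val: "goedel_valuation u"
    using u by (simp add: point_def)
  have inj: "inj_on (Bel a) X" for X :: "('p, 'a) fm set"
    by (auto simp: inj_on_def)
  define G where "G = {\<chi>. Bel a \<chi> \<in> S \<and> ?\<alpha> < u (Bel a \<chi>)}"
  have "finite (Bel a ` G)"
    by (rule finite_subset[OF _ finite_S]) (auto simp: G_def)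
  then have "finite G"
    using finite_imageD inj by blast
  then obtain xs where xs: "set xs = G" "distinct xs"
    using finite_distinct_list by blast
  have "\<not> D (Imp (Conj (xs @ map (Bel a) xs)) \<psi>)"
  proof
    assume "D (Imp (Conj (xs @ map (Bel a) xs)) \<psi>)"
    then have "u (Conj (map (Bel a) xs)) \<le> ?\<alpha>"
      using u \<psi> xs by (intro point_le Bel_Conj_Imp) (auto simp: G_def distinct_map inj)
    moreover define c where "c = Min (insert 1 (u ` Bel a ` G))"
    have "c \<le> u (Conj (map (Bel a) xs))"
      using val xs \<open>finite G\<close> by (simp add: le_goedel_valuation_Conj_iff c_def)
    moreover have "?\<alpha> < c"
      using \<psi> \<open>finite G\<close> by (simp add: c_def G_def)
    ultimately show False by simp
  qed
  then obtain v where v: "point v" "\<forall>x\<in>set (xs @ map (Bel a) xs). v x = 1" "v \<psi> \<le> \<epsilon>"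
    using ex_point_if_not_D \<epsilon> by blast
  have bound: "u (Bel a \<chi>) \<le> max ?\<alpha> (min (v \<chi>) (v (Bel a \<chi>)))" if "Bel a \<chi> \<in> S" for \<chi>
  proof (cases "\<chi> \<in> G")
    case True
    then show ?thesis
      using v(2) xs(1) goedel_valuationD(2)[OF val, of "Bel a \<chi>"] by auto
  next
    case False
    then show ?thesis
      using that by (simp add: G_def)
  qed
  then have "cost a u v \<le> ?\<alpha>"
    using goedel_valuationD(1)[OF val] by (simp add: cost_le_iff)
  then show ?thesis using v by blast
qed

lemma cost_le_1: "point u \<Longrightarrow> cost a u v \<le> 1"
  by (simp add: cost_le_iff point_def goedel_valuationD le_max_iff_disj)

lemma cost_trans: "cost a u w \<le> max (cost a u v) (cost a v w)"
  unfolding cost_le_iff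
proof (intro conjI allI impI)
  show "0 \<le> max (cost a u v) (cost a v w)"
    by (simp add: cost_nonneg le_max_iff_disj)
next
  fix \<chi> assume \<chi>: "Bel a \<chi> \<in> S"
  show "u (Bel a \<chi>) \<le> max (max (cost a u v) (cost a v w)) (min (w \<chi>) (w (Bel a \<chi>)))"
    using Bel_le_cost[OF \<chi>, of u v] Bel_le_cost[OF \<chi>, of v w] by linarith
qed

lemma cost_refl:
  assumes "\<And>a \<phi>. D (Imp (Bel a \<phi>) \<phi>)" "point u"
  shows "cost a u u = 0"
proof -
  have "u (Bel a \<chi>) \<le> u \<chi>" if "Bel a \<chi> \<in> S" for \<chi>
    using that assms Bel_S by (blast intro: point_le1)
  then have "cost a u u \<le> 0"
    by (simp add: cost_le_iff le_max_iff_disj)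
  then show ?thesis using cost_nonneg[of a u u] by simp
qed

definition canonical :: "(nat \<Rightarrow> ('p, 'a) fm \<Rightarrow> real) \<Rightarrow> ('p, 'a, nat) egl" where
  "canonical h = \<lparr>worlds = UNIV, acc = (\<lambda>a i j. 1 - cost a (h i) (h j)), valu = (\<lambda>i p. h i (Atom p))\<rparr>"

lemma canonical_simps [simp]:
  "worlds (canonical h) = UNIV"
  "acc (canonical h) a i j = 1 - cost a (h i) (h j)"
  "valu (canonical h) i p = h i (Atom p)"
  by (simp_all add: canonical_def)

context
  fixes h :: "nat \<Rightarrow> ('p, 'a) fm \<Rightarrow> real"
  assumes point_h: "point (h i)"
    and witness_h: "Bel a \<psi> \<in> S \<Longrightarrow> h i (Bel a \<psi>) < 1 \<Longrightarrow>
      \<exists>j. cost a (h i) (h j) \<le> h i (Bel a \<psi>) \<and> h j \<psi> \<le> 1 / Suc n"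
begin

lemma valuation_h: "goedel_valuation (h i)"
  using point_h by (simp add: point_def)

lemma egl_model_canonical: "egl_model (canonical h)"
  by (simp add: egl_model_def cost_nonneg cost_le_1 point_h goedel_valuationD[OF valuation_h])

lemma egl_transitive_canonical: "egl_transitive (canonical h)"
  unfolding egl_transitive_def
proof (intro allI ballI)
  fix a and i j k :: nat
  show "acc (canonical h) a i k \<ge> min (acc (canonical h) a i j) (acc (canonical h) a j k)"
    using cost_trans[of a "h i" "h k" "h j"] by simp
qed

lemma egl_serial_canonical: "egl_serial (canonical h)"
  unfolding egl_serial_def
proof (intro allI ballI)
  fix a and i :: nat
  have "\<exists>j. cost a (h i) (h j) \<le> 0"
  proof (cases "\<exists>\<psi>. Bel a \<psi> \<in> S")
    case True
    then have Bot: "Bel a Bot \<in> S"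
      using Bel_S by blast
    then have "h i (Bel a Bot) \<le> h i Bot"
      using point_h consistency Bot_S by (intro point_le1)
    then have "h i (Bel a Bot) = 0"
      using goedel_valuationD(1,3)[OF valuation_h, of i] by (simp add: order_antisym)
    then show ?thesis
      using witness_h[OF Bot, of i 0] by auto
  next
    case False
    then have "cost a (h i) (h i) \<le> 0"
      by (simp add: cost_le_iff)
    then show ?thesis by blast
  qed
  then obtain j where "cost a (h i) (h j) = 0"
    using cost_nonneg by (meson order_antisym)
  then show "\<exists>s'\<in>worlds (canonical h). acc (canonical h) a i s' = 1"
    by auto
qed

lemma truth_lemma: "\<phi> \<in> S \<Longrightarrow> val (canonical h) i \<phi> = h i \<phi>"
proof (induction \<phi> arbitrary: i)
  case (And \<phi> \<psi>)
  then show ?case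
    using And_S[OF And.prems] by (simp add: goedel_valuationD[OF valuation_h])
next
  case (Imp \<phi> \<psi>)
  then show ?case
    using Imp_S[OF Imp.prems] by (simp add: goedel_valuationD[OF valuation_h])
next
  case (Bel a \<psi>)
  have IH: "val (canonical h) j \<psi> = h j \<psi>" for j
    using Bel Bel_S by blast
  show ?case
  proof (rule antisym)
    show "h i (Bel a \<psi>) \<le> val (canonical h) i (Bel a \<psi>)"
    proof (rule le_val_Bel[OF egl_model_canonical])
      fix j
      show "h i (Bel a \<psi>) \<le> max (1 - acc (canonical h) a i j) (val (canonical h) j \<psi>)"
        using Bel_le_cost[OF Bel.prems, of "h i" "h j"] by (simp add: IH)
    qed
    show "val (canonical h) i (Bel a \<psi>) \<le> h i (Bel a \<psi>)"
    proof (cases "h i (Bel a \<psi>) < 1")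
      case True
      have le: "val (canonical h) i (Bel a \<psi>) \<le> h i (Bel a \<psi>) + 1 / Suc n" for n
      proof -
        obtain j where j: "cost a (h i) (h j) \<le> h i (Bel a \<psi>)" "h j \<psi> \<le> 1 / Suc n"
          using witness_h[OF Bel.prems True] by blast
        have "val (canonical h) i (Bel a \<psi>) \<le> max (cost a (h i) (h j)) (h j \<psi>)"
          using val_Bel_le[OF egl_model_canonical, of i j a \<psi>] by (simp add: IH del: val.simps)
        also have "\<dots> \<le> h i (Bel a \<psi>) + 1 / Suc n"
          using j goedel_valuationD(1)[OF valuation_h, of i "Bel a \<psi>"] by (auto intro: add_increasing add_increasing2)
        finally show ?thesis .
      qed
      show ?thesis
      proof (rule field_le_epsilon)
        fix e :: real assume "0 < e"
        then obtain n where "1 / Suc n < e"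
          using nat_approx_posE by metis
        then show "val (canonical h) i (Bel a \<psi>) \<le> h i (Bel a \<psi>) + e"
          using le[of n] by linarith
      qed
    next
      case False
      then show ?thesis
        using val_bounds[OF egl_model_canonical, of i "Bel a \<psi>"] by simp
    qed
  qed
qed (simp_all add: goedel_valuationD[OF valuation_h])

end

lemma ex_countermodel:
  assumes "\<phi> \<in> S" "\<not> D \<phi>"
  shows "\<exists>M :: ('p, 'a, nat) egl. egl_model M \<and> egl_serial M \<and> egl_transitive M \<and>
    ((\<forall>a \<psi>. D (Imp (Bel a \<psi>) \<psi>)) \<longrightarrow> egl_reflexive M) \<and> \<not> true_in M \<phi>"
proof -
  have "D (Conj [])"
    by (rule A, rule ax_A_if_goedel_valid) (simp add: goedel_valuationD goedel_imp_def)
  then have "\<not> D (Imp (Conj []) \<phi>)"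
    using assms(2) mp by blast
  then obtain u where u: "point u" "u \<phi> < 1"
    using ex_point_if_not_D[of "[]" \<phi> 1] by auto
  obtain bs where bs: "set bs = S"
    using finite_list[OF finite_S] by blast
  define R :: "nat \<times> nat \<Rightarrow> (('p, 'a) fm \<Rightarrow> real) \<Rightarrow> (('p, 'a) fm \<Rightarrow> real) \<Rightarrow> bool"
    where "R = (\<lambda>(k, n) u v. \<forall>a \<psi>. k < length bs \<and> bs ! k = Bel a \<psi> \<and> u (Bel a \<psi>) < 1 \<longrightarrow>
      cost a u v \<le> u (Bel a \<psi>) \<and> v \<psi> \<le> 1 / Suc n)"
  have step: "\<exists>v\<in>Collect point. R i u v" if u: "u \<in> Collect point" for i u
  proof -
    obtain k n where i: "i = (k, n)" by fastforce
    show ?thesis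
    proof (cases "\<exists>a \<psi>. k < length bs \<and> bs ! k = Bel a \<psi> \<and> u (Bel a \<psi>) < 1")
      case True
      then obtain a \<psi> where k: "k < length bs" "bs ! k = Bel a \<psi>" "u (Bel a \<psi>) < 1"
        by blast
      then have "Bel a \<psi> \<in> S"
        using bs nth_mem by metis
      then obtain v where "point v" "cost a u v \<le> u (Bel a \<psi>)" "v \<psi> \<le> 1 / Suc n"
        using witness[OF _ \<open>Bel a \<psi> \<in> S\<close>, of u "1 / Suc n"] k(3) u by auto
      then show ?thesis
        using k by (auto simp: R_def i)
    next
      case False
      then show ?thesis
        using u by (auto simp: R_def i)
    qed
  qed
  obtain h :: "nat \<Rightarrow> ('p, 'a) fm \<Rightarrow> real" where h: "range h \<subseteq> Collect point" "u \<in> range h"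
    "\<And>m i. \<exists>k. R i (h m) (h k)"
    using countable_closure[of u "Collect point" R, OF _ step] u by blast
  have point: "point (h i)" for i
    using h(1) by auto
  have wit: "\<exists>j. cost a (h i) (h j) \<le> h i (Bel a \<psi>) \<and> h j \<psi> \<le> 1 / Suc n"
    if \<psi>: "Bel a \<psi> \<in> S" "h i (Bel a \<psi>) < 1" for a \<psi> i n
  proof -
    obtain k where "k < length bs" "bs ! k = Bel a \<psi>"
      using bs \<psi>(1) in_set_conv_nth by metis
    then show ?thesis
      using h(3)[of "(k, n)" i] \<psi>(2) by (auto simp: R_def)
  qed
  obtain i where i: "h i = u"
    using h(2) by blast
  have "val (canonical h) i \<phi> \<noteq> 1"
    using truth_lemma[of h, OF point wit assms(1), of i] i u by simp
  then have "\<not> true_in (canonical h) \<phi>"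
    by (auto simp: true_in_def)
  moreover have "egl_reflexive (canonical h)" if "\<forall>a \<psi>. D (Imp (Bel a \<psi>) \<psi>)"
    using cost_refl that point by (simp add: egl_reflexive_def)
  ultimately show ?thesis
    using egl_model_canonical[of h, OF point wit] egl_serial_canonical[of h, OF point wit]
      egl_transitive_canonical[of h, OF point wit] by blast
qed

end

primrec subfms :: "('p, 'a) fm \<Rightarrow> ('p, 'a) fm set" where
  "subfms (Atom p) = {Atom p}"
| "subfms Bot = {Bot}"
| "subfms (And \<phi> \<psi>) = insert (And \<phi> \<psi>) (subfms \<phi> \<union> subfms \<psi>)"
| "subfms (Imp \<phi> \<psi>) = insert (Imp \<phi> \<psi>) (subfms \<phi> \<union> subfms \<psi>)"
| "subfms (Bel a \<phi>) = insert (Bel a \<phi>) (subfms \<phi>)"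

lemma finite_subfms: "finite (subfms \<phi>)"
  by (induction \<phi>) auto

lemma subfms_refl: "\<phi> \<in> subfms \<phi>"
  by (cases \<phi>) auto

lemma subfms_closed:
  "And \<alpha> \<beta> \<in> subfms \<phi> \<Longrightarrow> \<alpha> \<in> subfms \<phi> \<and> \<beta> \<in> subfms \<phi>"
  "Imp \<alpha> \<beta> \<in> subfms \<phi> \<Longrightarrow> \<alpha> \<in> subfms \<phi> \<and> \<beta> \<in> subfms \<phi>"
  "Bel a \<alpha> \<in> subfms \<phi> \<Longrightarrow> \<alpha> \<in> subfms \<phi>"
  by (induction \<phi>) (auto simp: subfms_refl)

theorem (in belief_logic) completeness:
  assumes "\<not> D \<phi>"
  shows "\<exists>M :: ('p, 'a, nat) egl. egl_model M \<and> egl_serial M \<and> egl_transitive M \<and>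
    ((\<forall>a \<psi>. D (Imp (Bel a \<psi>) \<psi>)) \<longrightarrow> egl_reflexive M) \<and> \<not> true_in M \<phi>"
proof -
  define B :: "('p, 'a) fm set" where "B = {Bel a Bot | a. \<exists>\<psi>. Bel a \<psi> \<in> subfms \<phi>}"
  have "B \<subseteq> (\<lambda>\<psi>. case \<psi> of Bel a _ \<Rightarrow> Bel a Bot | _ \<Rightarrow> Bot) ` subfms \<phi>"
    by (force simp: B_def)
  then have "finite B"
    using finite_subset finite_subfms by blast
  then interpret fragment D "subfms \<phi> \<union> B \<union> {Bot}"
    by unfold_locales (auto simp: finite_subfms B_def dest: subfms_closed)
  show ?thesis
    using ex_countermodel[OF _ assms] subfms_refl by blast
qed

section \<open>Completeness of the two systems\<close>

lemma belief_logic_derivable: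
  assumes "BF_axioms \<subseteq> Ax" "\<And>M. M \<in> C \<Longrightarrow> egl_model M" "\<And>\<phi>. \<phi> \<in> Ax \<Longrightarrow> valid_in C \<phi>"
  shows "belief_logic (derivable Ax C)"
proof
  show "derivable Ax C \<phi>" if "\<phi> \<in> ax_A" for \<phi>
    using that assms(1) by (intro derivable_axiom) (auto simp: BF_axioms_def KF_axioms_def)
  show "derivable Ax C (Imp (Bel a (Imp \<phi> \<psi>)) (Imp (Bel a \<phi>) (Bel a \<psi>)))" for a \<phi> \<psi>
    using assms(1) by (intro derivable_axiom) (auto simp: BF_axioms_def KF_axioms_def ax_K_def)
  show "derivable Ax C (Neg (Bel a Bot))" for a
    using assms(1) by (intro derivable_axiom) (auto simp: BF_axioms_def ax_D_def)
  show "derivable Ax C (Imp (Bel a \<phi>) (Bel a (Bel a \<phi>)))" for a \<phi>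
    using assms(1) by (intro derivable_axiom) (auto simp: BF_axioms_def ax_4_def)
  show "derivable Ax C \<psi>" if "derivable Ax C (Imp \<phi> \<psi>)" "derivable Ax C \<phi>" for \<phi> \<psi>
    using that by (rule derivable_mp)
  show "derivable Ax C (Bel a \<phi>)" if "derivable Ax C \<phi>" for a \<phi>
    using that derivable_sound[OF that assms(2,3)] by (rule derivable_nec)
qed

lemma BF_axioms_sound:
  assumes "\<phi> \<in> BF_axioms" "egl_model M" "egl_serial M" "egl_transitive M"
  shows "true_in M \<phi>"
  using assms ax_A_sound ax_K_sound ax_D_sound ax_4_sound
  unfolding BF_axioms_def KF_axioms_def by blast

lemma belief_logic_BF: "belief_logic BF_derivable"
  unfolding BF_derivable_def
  by (rule belief_logic_derivable)
    (auto simp: serial_transitive_models_def valid_in_def BF_axioms_sound)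

lemma belief_logic_TF: "belief_logic TF_derivable"
  unfolding TF_derivable_def
  by (rule belief_logic_derivable)
    (auto simp: serial_transitive_reflexive_models_def valid_in_def TF_axioms_def
      BF_axioms_sound ax_T_sound)

lemma TF_derivable_T: "TF_derivable (Imp (Bel a \<phi>) \<phi>)"
  unfolding TF_derivable_def by (rule derivable_axiom) (auto simp: TF_axioms_def ax_T_def)

theorem corollary4p1:
  shows "(\<forall>\<phi> :: ('p, 'a) fm.
            (\<forall>M :: ('p, 'a, nat) egl.
               egl_model M \<and> egl_serial M \<and> egl_transitive M \<longrightarrow> true_in M \<phi>)
            \<longrightarrow> BF_derivable \<phi>) \<and>
         (\<forall>\<phi> :: ('p, 'a) fm.
            (\<forall>M :: ('p, 'a, nat) egl.
               egl_model M \<and> egl_serial M \<and> egl_transitive M \<and> egl_reflexive M \<longrightarrow> true_in M \<phi>)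
            \<longrightarrow> TF_derivable \<phi>)"
  using belief_logic.completeness[OF belief_logic_BF] belief_logic.completeness[OF belief_logic_TF]
    TF_derivable_T by blast

end
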